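(* Let $-\tfrac12\le\alpha<1$ and let $f=h+\overline{g}\in\mathcal{M}(\alpha)$, where $h(z)=z+\sum_{k=2}^{\infty}a_kz^k$ and $g(z)=\sum_{k=1}^{\infty}b_kz^k$. Then $$|H_{3,1}(h)|\le\frac{1}{540}(1-\alpha)^{2}\bigl(15\alpha^{2}-34\alpha+52\bigr)$$ and $$|H_{3,1}(g)|\le\frac{1}{30}(1-\alpha).$$
   Context: Let $\mathbb{D}=\{z\in\mathbb{C}:|z|<1\}$. For real $\alpha$ with $-\tfrac12\le\alpha<1$, $\mathcal{M}(\alpha)$ denotes the class of harmonic mappings $f=h+\overline{g}$ in $\mathbb{D}$, where $h$ and $g$ are analytic in $\mathbb{D}$ of the form $$h(z)=z+\sum_{k=2}^{\infty}a_kz^k,\qquad g(z)=\sum_{k=1}^{\infty}b_kz^k\quad(|b_1|<1),$$ which satisfy $$\Re\Bigl(1+\frac{zh''(z)}{h'(z)}\Bigr)>\alpha\quad\text{and}\quad g'(z)=zh'(z)\qquad(z\in\mathbb{D}).$$ (In particular $b_1=0$.) For a function $F(z)=\sum_{k\ge1}c_kz^k$ analytic in $\mathbb{D}$, the third Hankel determinant is $$H_{3,1}(F)=\det\begin{pmatrix}c_1&c_2&c_3\\c_2&c_3&c_4\\c_3&c_4&c_5\end{pmatrix}.$$ Thus $H_{3,1}(h)$ is formed with $c_1=1$, $c_k=a_k$ for $k\ge2$, and $H_{3,1}(g)$ is formed with $c_k=b_k$. *)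

theory Defs
  imports "HOL-Complex_Analysis.Complex_Analysis"
begin

abbreviation unit_disc :: "complex set" where
  "unit_disc \<equiv> ball 0 1"

text \<open>Coefficient sequences are total; \<open>c 0 = 0\<close> expresses that the series starts at the linear term.\<close>

definition has_disc_expansion :: "(complex \<Rightarrow> complex) \<Rightarrow> (nat \<Rightarrow> complex) \<Rightarrow> bool" where
  "has_disc_expansion F c \<longleftrightarrow>
     F holomorphic_on unit_disc \<and> c 0 = 0 \<and>
     (\<forall>z\<in>unit_disc. (\<lambda>k. c k * z ^ k) sums F z)"

definition normalized_decomposition ::
  "(complex \<Rightarrow> complex) \<Rightarrow> (complex \<Rightarrow> complex) \<Rightarrow> (complex \<Rightarrow> complex) \<Rightarrow>
   (nat \<Rightarrow> complex) \<Rightarrow> (nat \<Rightarrow> complex) \<Rightarrow> bool" where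
  "normalized_decomposition f h g a b \<longleftrightarrow>
     has_disc_expansion h a \<and> a 1 = 1 \<and>
     has_disc_expansion g b \<and> cmod (b 1) < 1 \<and>
     (\<forall>z\<in>unit_disc. f z = h z + cnj (g z))"

text \<open>Only the values of \<open>f\<close> on the unit disc matter. The conjunct \<open>deriv h z \<noteq> 0\<close> makes the quotient
  meaningful, which is implicit in the informal condition; in HOL division by zero yields zero.\<close>

definition harmonic_class_M :: "real \<Rightarrow> (complex \<Rightarrow> complex) set" where
  "harmonic_class_M \<alpha> =
     {f. \<exists>h g a b. normalized_decomposition f h g a b \<and>
           (\<forall>z\<in>unit_disc.
              deriv h z \<noteq> 0 \<and>
              Re (1 + z * deriv (deriv h) z / deriv h z) > \<alpha> \<and>
              deriv g z = z * deriv h z)}"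

definition hankel_3_1 :: "(nat \<Rightarrow> complex) \<Rightarrow> complex" where
  "hankel_3_1 c =
     det (vector [vector [c 1, c 2, c 3],
                  vector [c 2, c 3, c 4],
                  vector [c 3, c 4, c 5]] :: complex ^ 3 ^ 3)"

end

theory Submission
  imports Defs
begin

text \<open>Put \<open>\<beta> = 1 - \<alpha>\<close> and write \<open>1 + z h'' / h' = 1 + \<beta> (p - 1)\<close> with \<open>Re p > 0\<close> and
  \<open>p = 1 + p1 z + p2 z^2 + \<dots>\<close>; let \<open>(p - 1) / (p + 1) = c1 z + c2 z^2 + \<dots>\<close>.
  Averaging a function over the rotations by \<open>n\<close>-th roots of unity removes the coefficients
  \<open>1, \<dots>, n - 1\<close>; a Moebius transformation and Cauchy's inequality then give \<open>|p_n| \<le> 2\<close> and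
  \<open>|c_n| \<le> 1 - |c1|^2\<close> for \<open>n \<ge> 2\<close>.

  The determinant of \<open>g\<close> is \<open>- \<beta> / 60\<close> times \<open>p3 - \<beta> p1 p2 + 2/9 \<beta>^2 p1^3\<close>, a convex combination of
  \<open>p3\<close>, \<open>p3 - p1 p2 = 2 (c3 - c1^3)\<close> and \<open>p3 - 2 p1 p2 + p1^3\<close>, where the last one is, up to sign,
  a coefficient of \<open>1 / p\<close>. The determinant of \<open>h\<close> is \<open>\<beta>^2 / 8640\<close> times
  \<open>- 60 p3 (p3 - 3/5 \<beta> p1 p2) + 72 (p2 - \<beta>/2 p1^2) p4 - 4 \<beta> p2^3
   + \<beta>^2 p1^2 (12 (p1 p3 - p2^2) - (3 p2 - \<beta> p1^2)^2)\<close>,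
  whose four terms are bounded by \<open>240\<close>, \<open>288\<close>, \<open>32 \<beta>\<close> and \<open>240 \<beta>^2\<close>.\<close>

subsection \<open>Coefficients of holomorphic functions on the disc\<close>

text \<open>Cauchy's inequality on the circle of radius \<open>r < 1\<close> gives
  \<open>|F_n| r^n \<le> 1\<close>. Nothing is known about \<open>f\<close> on the unit circle
  itself, so the bound is obtained by letting \<open>r\<close> tend to 1.\<close>

lemma fps_nth_bound_if_norm_le_1:
  fixes f :: "complex \<Rightarrow> complex"
  assumes hol: "f holomorphic_on ball 0 1" and exp: "f has_fps_expansion F"
    and le: "\<And>z. z \<in> ball 0 1 \<Longrightarrow> cmod (f z) \<le> 1"
  shows "cmod (fps_nth F n) \<le> 1"
proof -
  have bound: "cmod (fps_nth F n) * r ^ n \<le> 1" if r: "0 < r" "r < 1" for r :: real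
  proof -
    have "cmod ((deriv ^^ n) f 0) \<le> fact n * 1 / r ^ n"
    proof (rule Cauchy_inequality)
      show "f holomorphic_on ball 0 r"
        using hol by (rule holomorphic_on_subset) (use r in auto)
      show "continuous_on (cball 0 r) f"
        using holomorphic_on_imp_continuous_on[OF hol] by (rule continuous_on_subset) (use r in auto)
    qed (use r le in auto)
    moreover have "fps_nth F n = (deriv ^^ n) f 0 / fact n"
      by (rule fps_nth_fps_expansion[OF exp])
    ultimately have "cmod (fps_nth F n) \<le> 1 / r ^ n"
      by (simp add: norm_divide divide_le_eq)
    then show ?thesis
      using r by (simp add: pos_le_divide_eq)
  qed
  have "((\<lambda>r. cmod (fps_nth F n) * r ^ n) \<longlongrightarrow> cmod (fps_nth F n) * 1 ^ n) (at_left (1::real))"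
    by (intro tendsto_intros)
  moreover have "eventually (\<lambda>r. cmod (fps_nth F n) * r ^ n \<le> 1) (at_left (1::real))"
    using eventually_at_left_real[OF zero_less_one] by eventually_elim (use bound in auto)
  ultimately have "cmod (fps_nth F n) * 1 ^ n \<le> 1"
    by (rule tendsto_upperbound) simp
  then show ?thesis by simp
qed

text \<open>A geometric sum whose ratio is an \<open>n\<close>-th root of unity, and that ratio
  differs from 1 because \<open>n\<close> does not divide \<open>k\<close>.\<close>

lemma sum_cis_powers_eq_0:
  assumes "0 < k" "k < n"
  shows "(\<Sum>j<n. cis (2 * pi / real n) ^ (j * k)) = 0"
proof -
  define \<zeta> where "\<zeta> = cis (2 * pi / real n) ^ k"
  have "\<zeta> = cis (2 * pi * (real k / real n))"
    by (simp only: \<zeta>_def Complex.DeMoivre times_divide_eq_right mult_ac)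
  then have "\<zeta> = exp (\<i> * complex_of_real (2 * pi * (real k / real n)))"
    by (simp add: cis_conv_exp)
  have "\<zeta> \<noteq> 1"
  proof
    assume "\<zeta> = 1"
    then obtain m :: int where "2 * pi * (real k / real n) = of_int (2 * m) * pi"
      unfolding \<open>\<zeta> = exp _\<close> exp_eq_1 by auto
    then have "2 * pi * (real k / real n) = 2 * pi * of_int m"
      by (simp only: of_int_mult of_int_numeral mult_ac)
    then have m: "real k / real n = of_int m"
      by (simp only: mult_cancel_left) simp
    have "0 < real k / real n" "real k / real n < 1" using assms by auto
    with m show False by auto
  qed
  have "cis (2 * pi / real n) ^ n = 1"
    using assms by (simp add: Complex.DeMoivre)
  then have "\<zeta> ^ n = 1"
    by (simp only: \<zeta>_def mult.commute[of k] power_mult[symmetric]) (simp add: power_mult)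
  have "(\<Sum>j<n. cis (2 * pi / real n) ^ (j * k)) = (\<Sum>j<n. \<zeta> ^ j)"
    by (simp add: \<zeta>_def mult.commute flip: power_mult)
  also have "\<dots> = 0"
    using \<open>\<zeta> \<noteq> 1\<close> \<open>\<zeta> ^ n = 1\<close> by (simp add: geometric_sum)
  finally show ?thesis .
qed

text \<open>Let \<open>u\<close> be the constant term. The mean \<open>A\<close> of \<open>f\<close>
  over the rotations by \<open>n\<close>-th roots of unity stays in the convex set \<open>K\<close>
  and expands as \<open>u + F_n z^n + ...\<close>. The Moebius map
  \<open>(w - u) / (v + c w)\<close> sends \<open>K\<close> into the closed unit disc and
  \<open>u\<close> to 0, so \<open>F_n / (v + c u)\<close> is the \<open>n\<close>-th coefficient of
  a function bounded by 1.\<close>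

lemma fps_nth_bound_if_moebius_bound:
  fixes f :: "complex \<Rightarrow> complex"
  assumes hol: "f holomorphic_on ball 0 1" and exp: "f has_fps_expansion F"
    and K: "convex K" "\<And>z. z \<in> ball 0 1 \<Longrightarrow> f z \<in> K"
    and nz: "\<And>w. w \<in> K \<Longrightarrow> v + c * w \<noteq> 0"
    and le: "\<And>w. w \<in> K \<Longrightarrow> cmod (w - fps_nth F 0) \<le> cmod (v + c * w)"
    and n: "n > 0"
  shows "cmod (fps_nth F n) \<le> cmod (v + c * fps_nth F 0)"
proof -
  define \<zeta> where "\<zeta> = cis (2 * pi / real n)"
  define u where "u = fps_nth F 0"
  define A where "A = (\<lambda>z. \<Sum>j<n. (1 / real n) *\<^sub>R f (\<zeta> ^ j * z))"
  define G where "G = (\<Sum>j<n. fps_const (complex_of_real (1 / real n)) * (F oo (fps_const (\<zeta> ^ j) * fps_X)))"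
  have norm_\<zeta>: "cmod \<zeta> = 1" by (simp add: \<zeta>_def)
  have in_ball: "\<zeta> ^ j * z \<in> ball 0 1" if "z \<in> ball 0 1" for z j
    using that norm_\<zeta> by (simp add: norm_mult norm_power)
  have A_hol: "A holomorphic_on ball 0 1"
    unfolding A_def
  proof (intro holomorphic_intros)
    show "(\<lambda>z. f (\<zeta> ^ j * z)) holomorphic_on ball 0 1" for j
    proof (rule holomorphic_on_compose_gen[OF _ hol, unfolded o_def])
      show "(\<lambda>z. \<zeta> ^ j * z) ` ball 0 1 \<subseteq> ball 0 1" using in_ball by blast
    qed (intro holomorphic_intros)
  qed
  have A_exp: "A has_fps_expansion G"
    unfolding A_def G_def
  proof (intro has_fps_expansion_sum has_fps_expansion_scaleR)
    fix j
    have "(f \<circ> (\<lambda>z. \<zeta> ^ j * z)) has_fps_expansion (F oo (fps_const (\<zeta> ^ j) * fps_X))"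
      by (intro has_fps_expansion_compose exp fps_expansion_intros) simp
    then show "(\<lambda>z. f (\<zeta> ^ j * z)) has_fps_expansion (F oo (fps_const (\<zeta> ^ j) * fps_X))"
      by (simp add: o_def)
  qed
  have A_K: "A z \<in> K" if "z \<in> ball 0 1" for z
    unfolding A_def using n in_ball[OF that] K by (intro convex_sum) auto
  \<comment> \<open>Averaging multiplies the \<open>k\<close>-th coefficient by the mean of the
    \<open>k\<close>-th powers of all \<open>n\<close>-th roots of unity: 1 for \<open>k = 0\<close>
    and \<open>k = n\<close>, and 0 strictly between.\<close>
  have G_nth: "fps_nth G k = of_real (1 / real n) * fps_nth F k * (\<Sum>j<n. \<zeta> ^ (j * k))" for k
    unfolding G_def fps_sum_nth sum_distrib_left by (intro sum.cong refl) (simp add: power_mult)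
  have "fps_nth G 0 = u" using n by (simp add: G_nth u_def)
  have "\<zeta> ^ n = 1" using n by (simp add: \<zeta>_def Complex.DeMoivre)
  then have "\<zeta> ^ (j * n) = 1" for j
    by (simp only: mult.commute[of j] power_mult power_one)
  then have "fps_nth G n = fps_nth F n"
    using n by (simp add: G_nth)
  have gap: "fps_nth (G - fps_const u) k = 0" if "k < n" for k
    using that \<open>fps_nth G 0 = u\<close> sum_cis_powers_eq_0[of k n]
    by (cases "k = 0") (auto simp: G_nth \<zeta>_def)
  \<comment> \<open>With the factor \<open>X^n\<close> split off, the \<open>n\<close>-th
    coefficient of the quotient is a product of constant terms, so only the constant term of
    \<open>D\<close> matters.\<close>
  define S where "S = fps_shift n (G - fps_const u)"
  have GS: "G - fps_const u = S * fps_X ^ n"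
    unfolding S_def by (rule fps_ext) (use gap in \<open>auto simp: fps_X_power_mult_right_nth\<close>)
  define D where "D = fps_const v + fps_const c * G"
  define M where "M = (\<lambda>z. (A z - u) * inverse (v + c * A z))"
  have "f 0 = u"
    using has_fps_expansion_imp_0_eq_fps_nth_0[OF exp] by (simp add: u_def)
  then have "u \<in> K" using K(2)[of 0] by simp
  have D0: "fps_nth D 0 = v + c * u"
    by (simp add: D_def \<open>fps_nth G 0 = u\<close>)
  have "cmod (fps_nth ((G - fps_const u) * inverse D) n) \<le> 1"
  proof (rule fps_nth_bound_if_norm_le_1)
    show "M holomorphic_on ball 0 1"
      unfolding M_def by (intro holomorphic_intros A_hol) (use nz A_K in auto)
    show "M has_fps_expansion (G - fps_const u) * inverse D"
      unfolding M_def D_def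
      by (intro fps_expansion_intros A_exp) (use nz[OF \<open>u \<in> K\<close>] in \<open>simp add: \<open>fps_nth G 0 = u\<close>\<close>)
    show "cmod (M z) \<le> 1" if "z \<in> ball 0 1" for z
      using le[OF A_K[OF that]] nz[OF A_K[OF that]]
      by (simp add: M_def norm_divide divide_le_eq u_def flip: divide_inverse)
  qed
  also have "(G - fps_const u) * inverse D = S * inverse D * fps_X ^ n"
    by (simp only: GS mult_ac)
  also have "fps_nth (S * inverse D * fps_X ^ n) n = fps_nth (S * inverse D) 0"
    by (simp only: fps_X_power_mult_right_nth less_irrefl if_False diff_self_eq_0)
  also have "\<dots> = fps_nth F n / (v + c * u)"
    using n by (simp add: S_def D0 \<open>fps_nth G n = fps_nth F n\<close> field_simps)
  finally show ?thesis
    using nz[OF \<open>u \<in> K\<close>] by (simp add: norm_divide field_simps u_def)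
qed

text \<open>Here \<open>K\<close> is the right half-plane and the Moebius map is
  \<open>(w - 1) / (w + 1)\<close>; the bound is the value of its denominator at
  \<open>w = 1\<close>.\<close>

lemma caratheodory_coeff_bound:
  fixes p :: "complex \<Rightarrow> complex"
  assumes hol: "p holomorphic_on ball 0 1" and exp: "p has_fps_expansion P"
    and pos: "\<And>z. z \<in> ball 0 1 \<Longrightarrow> 0 < Re (p z)" and P0: "fps_nth P 0 = 1" and n: "0 < n"
  shows "cmod (fps_nth P n) \<le> 2"
proof -
  have "cmod (fps_nth P n) \<le> cmod (1 + 1 * fps_nth P 0)"
  proof (rule fps_nth_bound_if_moebius_bound[OF hol exp])
    show "convex {w. 0 < Re w}"
      by (rule convex_halfspace_Re_gt)
    show "1 + 1 * w \<noteq> 0" if "w \<in> {w. 0 < Re w}" for w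
      using that by (auto simp: complex_eq_iff)
    show "cmod (w - fps_nth P 0) \<le> cmod (1 + 1 * w)" if "w \<in> {w. 0 < Re w}" for w
      using that by (simp add: P0 cmod_def power2_eq_square algebra_simps)
  qed (use pos n in auto)
  then show ?thesis by (simp add: P0)
qed

text \<open>Here \<open>K\<close> is the closed disc and the Moebius map is
  \<open>(w - u) / (1 - cnj u * w)\<close>, whose denominator at \<open>u\<close> is
  \<open>1 - |u|^2\<close>.\<close>

lemma schur_coeff_bound:
  fixes f :: "complex \<Rightarrow> complex"
  assumes hol: "f holomorphic_on ball 0 1" and exp: "f has_fps_expansion F"
    and le: "\<And>z. z \<in> ball 0 1 \<Longrightarrow> cmod (f z) \<le> 1" and n: "0 < n"
  shows "cmod (fps_nth F n) \<le> 1 - (cmod (fps_nth F 0))\<^sup>2"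
proof -
  let ?u = "fps_nth F 0"
  have u_le: "cmod ?u \<le> 1"
    using fps_nth_bound_if_norm_le_1[OF hol exp le] .
  \<comment> \<open>If \<open>|u| = 1\<close>, the denominator vanishes at \<open>w = u\<close>.
    Replacing \<open>f\<close> by \<open>r f\<close> with \<open>r < 1\<close> keeps it nonzero on
    the closed disc; the limit \<open>r\<close> to 1 follows below.\<close>
  have *: "cmod (of_real r * fps_nth F n) \<le> cmod (1 + - cnj (of_real r * ?u) * (of_real r * ?u))"
    if r: "0 < r" "r < 1" for r :: real
  proof -
    let ?ru = "of_real r * ?u"
    have "r * cmod ?u \<le> r * 1"
      using u_le r by (intro mult_left_mono) auto
    then have "r * cmod ?u < 1" using r by linarith
    then have ru: "cmod ?ru < 1" using r by (simp add: norm_mult)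
    have exp': "(\<lambda>z. of_real r * f z) has_fps_expansion fps_const (of_real r) * F"
      by (intro fps_expansion_intros exp)
    have hol': "(\<lambda>z. of_real r * f z) holomorphic_on ball 0 1"
      by (intro holomorphic_intros hol)
    have "cmod (fps_nth (fps_const (of_real r) * F) n)
        \<le> cmod (1 + - cnj ?ru * fps_nth (fps_const (of_real r) * F) 0)"
    proof (rule fps_nth_bound_if_moebius_bound[OF hol' exp'])
      show "convex (cball (0::complex) 1)" by simp
      show "of_real r * f z \<in> cball 0 1" if "z \<in> ball 0 1" for z
        using mult_mono[of r 1 "cmod (f z)" 1] le[OF that] r by (simp add: norm_mult)
      show "1 + - cnj ?ru * w \<noteq> 0" if "w \<in> cball 0 1" for w
      proof
        assume "1 + - cnj ?ru * w = 0"
        then have "cnj ?ru * w = 1" by simp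
        then have "cmod ?ru * cmod w = 1"
          by (metis complex_mod_cnj norm_mult norm_one)
        moreover have "cmod ?ru * cmod w \<le> cmod ?ru"
          using that by (intro mult_left_le) auto
        ultimately show False using ru by linarith
      qed
      show "cmod (w - fps_nth (fps_const (of_real r) * F) 0) \<le> cmod (1 + - cnj ?ru * w)"
        if "w \<in> cball 0 1" for w
      proof -
        \<comment> \<open>The squared moduli of denominator and numerator differ by a product that
          is nonnegative on the disc.\<close>
        have "(cmod (w - ?ru))\<^sup>2 + (1 - (cmod w)\<^sup>2) * (1 - (cmod ?ru)\<^sup>2) = (cmod (1 + - cnj ?ru * w))\<^sup>2"
          unfolding cmod_power2 by (simp add: power2_eq_square algebra_simps)
        moreover have "0 \<le> (1 - (cmod w)\<^sup>2) * (1 - (cmod ?ru)\<^sup>2)"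
          using that ru by (intro mult_nonneg_nonneg) (auto simp: power_le_one)
        ultimately have "(cmod (w - ?ru))\<^sup>2 \<le> (cmod (1 + - cnj ?ru * w))\<^sup>2" by linarith
        then show ?thesis
          by (simp add: power2_le_imp_le[OF _ norm_ge_zero])
      qed
    qed (use n in auto)
    then show ?thesis by simp
  qed
  have "((\<lambda>r. cmod (of_real r * fps_nth F n)) \<longlongrightarrow> cmod (of_real 1 * fps_nth F n)) (at_left (1::real))"
    by (intro tendsto_intros)
  moreover have "((\<lambda>r. cmod (1 + - cnj (of_real r * ?u) * (of_real r * ?u)))
      \<longlongrightarrow> cmod (1 + - cnj (of_real 1 * ?u) * (of_real 1 * ?u))) (at_left (1::real))"
    by (intro tendsto_intros)
  moreover have "eventually (\<lambda>r. cmod (of_real r * fps_nth F n)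
      \<le> cmod (1 + - cnj (of_real r * ?u) * (of_real r * ?u))) (at_left (1::real))"
    using eventually_at_left_real[OF zero_less_one] by eventually_elim (use * in auto)
  ultimately have "cmod (of_real 1 * fps_nth F n) \<le> cmod (1 + - cnj (of_real 1 * ?u) * (of_real 1 * ?u))"
    by (intro tendsto_le[of "at_left (1::real)"]) auto
  also have "1 + - cnj (of_real 1 * ?u) * (of_real 1 * ?u) = of_real (1 - (cmod ?u)\<^sup>2)"
    by (simp add: complex_norm_square mult.commute del: of_real_power)
  also have "cmod \<dots> = 1 - (cmod ?u)\<^sup>2"
    using u_le by (simp add: power_le_one del: of_real_diff of_real_power)
  finally show ?thesis by simp
qed

subsection \<open>Uniqueness of the harmonic decomposition\<close>

text \<open>By the open mapping theorem a nonconstant \<open>f\<close> would also take the value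
  \<open>f z + i e/2\<close>, which is off the real axis.\<close>

lemma holomorphic_on_real_valued_imp_constant:
  assumes hol: "f holomorphic_on S" and S: "open S" "connected S"
    and real: "\<And>z. z \<in> S \<Longrightarrow> Im (f z) = 0" and z: "z \<in> S" and w: "w \<in> S"
  shows "f z = f w"
proof (rule ccontr)
  assume "f z \<noteq> f w"
  then have "\<not> f constant_on S"
    using z w unfolding constant_on_def by metis
  then have "open (f ` S)"
    using open_mapping_thm[OF hol S S(1)] by simp
  then obtain e where e: "e > 0" "ball (f z) e \<subseteq> f ` S"
    using z by (auto simp: open_contains_ball)
  have "f z + \<i> * of_real (e / 2) \<in> ball (f z) e"
    using e by (simp add: dist_norm norm_mult)
  then obtain y where "y \<in> S" "f z + \<i> * of_real (e / 2) = f y"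
    using e by auto
  then have "Im (f z) + e / 2 = Im (f y)"
    by (auto dest: arg_cong[of _ _ Im])
  then show False
    using e real[OF z] real[OF \<open>y \<in> S\<close>] by simp
qed

text \<open>Needed because membership in the class only provides some decomposition of
  \<open>f\<close>. With \<open>u = h - h'\<close> and \<open>v = g' - g\<close> one has
  \<open>u = cnj v\<close>, so \<open>u + v\<close> and \<open>i (u - v)\<close> are holomorphic and
  real, hence constant, and they vanish at 0.\<close>

lemma normalized_decomposition_unique:
  assumes 1: "normalized_decomposition f h g a b" and 2: "normalized_decomposition f h' g' a' b'"
    and z: "z \<in> unit_disc"
  shows "h z = h' z" "g z = g' z"
proof -
  have hol: "h holomorphic_on unit_disc" "g holomorphic_on unit_disc"
    "h' holomorphic_on unit_disc" "g' holomorphic_on unit_disc"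
    using 1 2 by (auto simp: normalized_decomposition_def has_disc_expansion_def)
  have at_0: "F 0 = 0" if "has_disc_expansion F c" for F c
  proof -
    have "c 0 = 0" and sums: "\<forall>z\<in>unit_disc. (\<lambda>k. c k * z ^ k) sums F z"
      using that by (simp_all add: has_disc_expansion_def)
    have "(\<lambda>k. c k * 0 ^ k) sums F 0"
      by (rule bspec[OF sums]) simp
    then have "F 0 = c 0"
      by (rule sums_unique2[OF _ powser_sums_zero])
    with \<open>c 0 = 0\<close> show ?thesis by simp
  qed
  have zero: "h 0 = 0" "g 0 = 0" "h' 0 = 0" "g' 0 = 0"
    using 1 2 at_0 by (auto simp: normalized_decomposition_def)
  define u v where "u = (\<lambda>z. h z - h' z)" and "v = (\<lambda>z. g' z - g z)"
  have uv: "u z = cnj (v z)" if "z \<in> unit_disc" for z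
  proof -
    have "h z + cnj (g z) = h' z + cnj (g' z)"
      using 1 2 that by (simp add: normalized_decomposition_def)
    then show ?thesis by (simp add: u_def v_def algebra_simps)
  qed
  have "u z + v z = u 0 + v 0"
    by (rule holomorphic_on_real_valued_imp_constant[where f = "\<lambda>z. u z + v z" and S = unit_disc])
       (use uv z hol in \<open>auto simp: u_def v_def intro!: holomorphic_intros\<close>)
  moreover have "\<i> * (u z - v z) = \<i> * (u 0 - v 0)"
    by (rule holomorphic_on_real_valued_imp_constant[where f = "\<lambda>z. \<i> * (u z - v z)" and S = unit_disc])
       (use uv z hol in \<open>auto simp: u_def v_def intro!: holomorphic_intros\<close>)
  ultimately have "u z = 0 \<and> v z = 0"
    using zero by (auto simp: u_def v_def)
  then show "h z = h' z" "g z = g' z"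
    by (auto simp: u_def v_def)
qed

subsection \<open>Bounds for the coefficient functionals\<close>

lemma hankel_3_1_eq:
  "hankel_3_1 c = c 1 * c 3 * c 5 + 2 * (c 2 * c 3 * c 4) - c 1 * (c 4)\<^sup>2 - (c 2)\<^sup>2 * c 5 - (c 3) ^ 3"
  unfolding hankel_3_1_def det_3 vector_3 by (simp add: algebra_simps power2_eq_square power3_eq_cube)

lemma norm_real_combination_le:
  fixes z w :: complex
  assumes "cmod z \<le> M" "cmod w \<le> N"
  shows "cmod (of_real r * z + of_real s * w) \<le> \<bar>r\<bar> * M + \<bar>s\<bar> * N"
  by (rule norm_triangle_mono) (use assms in \<open>simp_all add: norm_mult mult_left_mono\<close>)

text \<open>The functional is a convex combination of the three bounded quantities, with weights
  \<open>1 - s - t\<close>, \<open>t\<close>, \<open>s\<close>. Matching the coefficients of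
  \<open>p1^3\<close> and \<open>p1 p2\<close> forces \<open>s = 2/9 \<beta>^2\<close> and
  \<open>t + 2 s = \<beta>\<close>.\<close>

lemma cubic_functional_bound:
  fixes p1 p2 p3 :: complex and \<beta> :: real
  assumes \<beta>: "0 \<le> \<beta>" "\<beta> \<le> 3 / 2"
    and "cmod p3 \<le> 2" and "cmod (p3 - p1 * p2) \<le> 2" and "cmod (p3 - 2 * p1 * p2 + p1 ^ 3) \<le> 2"
  shows "cmod (p3 - of_real \<beta> * p1 * p2 + of_real (2 / 9 * \<beta>\<^sup>2) * p1 ^ 3) \<le> 2"
proof -
  define s where "s = 2 / 9 * \<beta>\<^sup>2"
  define t where "t = \<beta> - 2 * s"
  have "t = \<beta> * (1 - 4 / 9 * \<beta>)" by (simp add: t_def s_def power2_eq_square algebra_simps)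
  then have "0 \<le> t" using \<beta> by simp
  have "0 \<le> s" by (simp add: s_def)
  \<comment> \<open>The first weight vanishes at \<open>\<beta> = 3/2\<close>, so the lower bound
    -1/2 for \<alpha> is exactly what keeps it nonnegative.\<close>
  have "0 \<le> 2 * ((3 / 2 - \<beta>) * (3 - \<beta>))" using \<beta> by simp
  also have "\<dots> = 9 * (1 - s - t)"
    unfolding s_def t_def by (simp add: power2_eq_square right_diff_distrib left_diff_distrib)
  finally have "0 \<le> 1 - s - t" by simp
  have "p3 - of_real \<beta> * p1 * p2 + of_real s * p1 ^ 3
      = of_real (1 - s - t) * p3 + of_real t * (p3 - p1 * p2) + of_real s * (p3 - 2 * p1 * p2 + p1 ^ 3)"
    by (simp add: t_def algebra_simps)
  also have "cmod \<dots> \<le> (1 - s - t) * 2 + t * 2 + s * 2"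
  proof (rule norm_triangle_mono)
    show "cmod (of_real (1 - s - t) * p3 + of_real t * (p3 - p1 * p2)) \<le> (1 - s - t) * 2 + t * 2"
      using norm_real_combination_le[OF assms(3) assms(4), of "1 - s - t" t] \<open>0 \<le> t\<close> \<open>0 \<le> 1 - s - t\<close>
      by (simp only: abs_of_nonneg)
  qed (use \<open>0 \<le> s\<close> in \<open>simp add: norm_mult mult_left_mono[OF assms(5)]\<close>)
  also have "\<dots> = 2" by (simp add: algebra_simps)
  finally show ?thesis by (simp add: s_def)
qed

text \<open>The bound is 16 times the quadratic polynomial of the theorem, rewritten in
  \<open>\<beta> = 1 - \<alpha>\<close>. The four groups are estimated separately, the last two with
  room to spare.\<close>

lemma hankel_functional_bound:
  fixes c1 c2 c3 p1 p2 p3 p4 :: complex and \<beta> :: real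
  defines "b \<equiv> complex_of_real \<beta>"
  assumes \<beta>: "0 < \<beta>" "\<beta> \<le> 3 / 2"
    and c1: "cmod c1 \<le> 1" and c2: "cmod c2 \<le> 1 - (cmod c1)\<^sup>2" and c3: "cmod c3 \<le> 1 - (cmod c1)\<^sup>2"
    and p1: "p1 = 2 * c1" and p2: "p2 = 2 * (c2 + c1\<^sup>2)" and p3: "p3 = 2 * (c3 + 2 * c1 * c2 + c1 ^ 3)"
    and bounds: "cmod p2 \<le> 2" "cmod p3 \<le> 2" "cmod p4 \<le> 2" "cmod (p3 - p1 * p2) \<le> 2"
  shows "cmod (- 60 * p3\<^sup>2 + 72 * p2 * p4 - 36 * b * p1\<^sup>2 * p4 + 36 * b * p1 * p2 * p3 - 4 * b * p2 ^ 3
            - 21 * b\<^sup>2 * p1\<^sup>2 * p2\<^sup>2 + 12 * b\<^sup>2 * p1 ^ 3 * p3 + 6 * b ^ 3 * p1 ^ 4 * p2 - b ^ 4 * p1 ^ 6)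
         \<le> 528 + 64 * \<beta> + 240 * \<beta>\<^sup>2" (is "cmod ?E \<le> _")
proof -
  define x where "x = cmod c1"
  define u where "u = x\<^sup>2"
  have x: "0 \<le> x" "x \<le> 1" using c1 by (auto simp: x_def)
  have u: "0 \<le> u" "u \<le> 1" using x by (auto simp: u_def power_le_one)
  have c2': "cmod c2 \<le> 1 - u" and c3': "cmod c3 \<le> 1 - u"
    using c2 c3 by (auto simp: u_def x_def)
  have norm_c1: "cmod (of_real r * c1\<^sup>2) = \<bar>r\<bar> * u" for r
    by (simp add: norm_mult norm_power u_def x_def)
  \<comment> \<open>In terms of the \<open>c\<close>'s, \<open>p1 p3 - p2^2\<close> becomes
    \<open>4 (c1 c3 - c2^2)\<close>, and the combinations of \<open>p2\<close> and
    \<open>p1^2\<close> become \<open>c2\<close> plus a real multiple of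
    \<open>c1^2\<close>.\<close>
  have E: "?E = - (p3 * ((60 - 36 * b) * p3 + 36 * b * (p3 - p1 * p2)))
           + 144 * (c2 + (1 - b) * c1\<^sup>2) * p4 - 4 * b * p2 ^ 3
           + b\<^sup>2 * p1\<^sup>2 * (48 * (c1 * c3 - c2\<^sup>2) - (6 * c2 + (6 - 4 * b) * c1\<^sup>2)\<^sup>2)"
    (is "_ = - ?T1 + ?T2 - ?T3 + ?T4")
    unfolding p1 p2 p3 by algebra
  have "cmod ?E \<le> cmod ?T1 + cmod ?T2 + cmod ?T3 + cmod ?T4"
    using norm_triangle_ineq[of "- ?T1" ?T2] norm_triangle_ineq4[of "- ?T1 + ?T2" ?T3]
      norm_triangle_ineq[of "- ?T1 + ?T2 - ?T3" ?T4] unfolding E norm_minus_cancel by linarith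
  moreover have "cmod ?T1 \<le> 2 * 120"
  proof -
    have "cmod ((60 - 36 * b) * p3 + 36 * b * (p3 - p1 * p2)) \<le> 120"
    proof -
      \<comment> \<open>Both weights are nonnegative and add up to 60.\<close>
      have "cmod (of_real (60 - 36 * \<beta>) * p3 + of_real (36 * \<beta>) * (p3 - p1 * p2))
          \<le> \<bar>60 - 36 * \<beta>\<bar> * 2 + \<bar>36 * \<beta>\<bar> * 2"
        by (rule norm_real_combination_le[OF bounds(2) bounds(4)])
      also have "\<dots> = 120"
        using \<beta> by (simp only: abs_of_nonneg) auto
      finally show ?thesis
        by (simp only: b_def of_real_diff of_real_mult of_real_numeral)
    qed
    then show ?thesis
      unfolding norm_mult[of p3] using bounds by (intro mult_mono) auto
  qed
  moreover have "cmod ?T2 \<le> 144 * 2"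
  proof -
    \<comment> \<open>Since \<open>|1 - \<beta>| \<le> 1\<close>, the two summands are at most
      \<open>1 - u\<close> and \<open>u\<close>.\<close>
    have "\<bar>1 - \<beta>\<bar> * u \<le> 1 * u"
      using \<beta> u by (intro mult_right_mono) auto
    then have "cmod (c2 + (1 - b) * c1\<^sup>2) \<le> 1"
      using norm_triangle_ineq[of c2 "(1 - b) * c1\<^sup>2"] norm_c1[of "1 - \<beta>"] c2' by (simp add: b_def)
    then have "cmod (144 * (c2 + (1 - b) * c1\<^sup>2)) \<le> 144"
      by (simp only: norm_mult[of 144]) simp
    then show ?thesis
      unfolding norm_mult[of _ p4] using bounds by (intro mult_mono) auto
  qed
  moreover have "cmod ?T3 \<le> 4 * \<beta> * 2 ^ 3"
    unfolding norm_mult norm_power b_def using bounds \<beta> by (intro mult_mono power_mono) auto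
  moreover have "cmod ?T4 \<le> \<beta>\<^sup>2 * 240"
  proof -
    have "\<bar>6 - 4 * \<beta>\<bar> * u \<le> 6 * u"
      using \<beta> u by (intro mult_right_mono) auto
    then have "cmod (6 * c2 + (6 - 4 * b) * c1\<^sup>2) \<le> 6"
      using norm_triangle_ineq[of "6 * c2" "(6 - 4 * b) * c1\<^sup>2"] norm_c1[of "6 - 4 * \<beta>"] c2'
      by (simp add: b_def norm_mult[of 6])
    then have 1: "cmod ((6 * c2 + (6 - 4 * b) * c1\<^sup>2)\<^sup>2) \<le> 36"
      using power_mono[of _ 6 2] by (fastforce simp: norm_power)
    have "cmod (c1 * c3) \<le> x * (1 - u)" "cmod (c2\<^sup>2) \<le> (1 - u)\<^sup>2"
      using c2' c3' x by (simp_all add: norm_mult norm_power mult_left_mono power_mono flip: x_def)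
    then have "cmod (c1 * c3 - c2\<^sup>2) \<le> x * (1 - u) + (1 - u)\<^sup>2"
      using norm_triangle_ineq4[of "c1 * c3" "c2\<^sup>2"] by linarith
    \<comment> \<open>Completing the square in \<open>1 + x - x^2\<close>, the cofactor of
      \<open>1 - u\<close>, shows that this factor is at most 5/4; 48 times 5/4 is the 60
      below.\<close>
    also have "\<dots> = (1 - u) * (5 / 4 - (x - 1 / 2)\<^sup>2)"
      by (simp add: u_def power2_eq_square algebra_simps)
    also have "\<dots> \<le> (1 - u) * (5 / 4)"
      using u by (intro mult_left_mono) auto
    finally have 2: "cmod (48 * (c1 * c3 - c2\<^sup>2)) \<le> 60 * (1 - u)"
      unfolding norm_mult[of 48] by simp
    have "cmod (48 * (c1 * c3 - c2\<^sup>2) - (6 * c2 + (6 - 4 * b) * c1\<^sup>2)\<^sup>2) \<le> 60 * (1 - u) + 36"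
      using norm_triangle_ineq4 1 2 by (smt (verit))
    moreover have "cmod (b\<^sup>2 * p1\<^sup>2) = \<beta>\<^sup>2 * (4 * u)"
      by (simp add: b_def p1 norm_mult norm_power u_def x_def power_mult_distrib)
    ultimately have "cmod ?T4 \<le> \<beta>\<^sup>2 * (4 * u) * (60 * (1 - u) + 36)"
      unfolding norm_mult[of "b\<^sup>2 * p1\<^sup>2"] using u by (simp add: mult_left_mono)
    \<comment> \<open>The maximum over \<open>u\<close>, attained at 4/5, is 768/5; the weaker 240
      is all that the final polynomial requires.\<close>
    also have "\<dots> = \<beta>\<^sup>2 * (768 / 5 - 240 * (u - 4 / 5)\<^sup>2)"
      by (simp add: power2_eq_square algebra_simps)
    also have "\<dots> \<le> \<beta>\<^sup>2 * 240"
      using zero_le_power2[of "u - 4 / 5"] by (intro mult_left_mono) (linarith, simp)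
    finally show ?thesis .
  qed
  ultimately have "cmod ?E \<le> 2 * 120 + 144 * 2 + 4 * \<beta> * 2 ^ 3 + \<beta>\<^sup>2 * 240"
    by (rule order.trans[OF _ add_mono[OF add_mono[OF add_mono]]])
  then show ?thesis using \<beta> by simp
qed

subsection \<open>Coefficients of functions convex of a given order\<close>

lemma has_disc_expansion_imp_has_fps_expansion:
  assumes "has_disc_expansion F c"
  shows "F has_fps_expansion Abs_fps c"
proof (rule has_fps_expansionI)
  have "eventually (\<lambda>z. z \<in> unit_disc) (nhds 0)"
    by (rule eventually_nhds_in_open) auto
  then show "eventually (\<lambda>z. (\<lambda>n. fps_nth (Abs_fps c) n * z ^ n) sums F z) (nhds 0)"
    by eventually_elim (use assms in \<open>simp add: has_disc_expansion_def\<close>)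
qed

lemma has_fps_expansion_unique_on_disc:
  assumes "f has_fps_expansion F" "g has_fps_expansion G" "\<And>z. z \<in> unit_disc \<Longrightarrow> f z = g z"
  shows "F = G"
proof -
  have "eventually (\<lambda>z. z \<in> unit_disc) (nhds 0)"
    by (rule eventually_nhds_in_open) auto
  then have "eventually (\<lambda>z. f z = g z) (nhds 0)"
    by eventually_elim (rule assms(3))
  then have "f has_fps_expansion G"
    using assms(2) has_fps_expansion_cong by blast
  with assms(1) show ?thesis
    by (rule fps_expansion_unique_complex)
qed

lemma holomorphic_on_disc_imp_has_fps_expansion:
  assumes "f holomorphic_on unit_disc"
  shows "f has_fps_expansion fps_expansion f 0"
  using assms by (intro analytic_at_imp_has_fps_expansion_0) (auto simp: analytic_at intro!: exI[of _ unit_disc])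

text \<open>With \<open>p = 1 + z k\<close>, the function \<phi> is \<open>(p - 1) / (p + 1)\<close>
  divided by \<open>z\<close>, written so that no singularity at 0 arises. The Schwarz lemma for
  \<open>\<omega> = z \<phi>\<close> bounds \<phi> away from 0, and its derivative part bounds
  \<open>\<phi> 0 = \<omega>' 0\<close>.\<close>

lemma norm_quotient_le_1_if_Re_pos:
  assumes hol: "k holomorphic_on unit_disc"
    and pos: "\<And>z. z \<in> unit_disc \<Longrightarrow> 0 < Re (1 + z * k z)" and z: "z \<in> unit_disc"
  shows "cmod (k z / (2 + z * k z)) \<le> 1"
proof -
  define \<phi> where "\<phi> = (\<lambda>z. k z / (2 + z * k z))"
  have nz: "2 + z * k z \<noteq> 0" if "z \<in> unit_disc" for z
  proof
    assume "2 + z * k z = 0"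
    then have "1 + z * k z = -1" by (simp add: algebra_simps add_eq_0_iff)
    with pos[OF that] show False by simp
  qed
  have \<phi>_hol: "\<phi> holomorphic_on unit_disc"
    unfolding \<phi>_def by (intro holomorphic_intros hol) (use nz in auto)
  define \<omega> where "\<omega> = (\<lambda>z. z * \<phi> z)"
  have \<omega>_hol: "\<omega> holomorphic_on unit_disc"
    unfolding \<omega>_def by (intro holomorphic_intros \<phi>_hol)
  have \<omega>_0: "\<omega> 0 = 0" by (simp add: \<omega>_def)
  have \<omega>_less: "cmod (\<omega> z) < 1" if "cmod z < 1" for z
  proof -
    have "z \<in> unit_disc" using that by simp
    define w where "w = z * k z"
    have "0 < 1 + Re w" using pos[OF \<open>z \<in> unit_disc\<close>] by (simp add: w_def)
    \<comment> \<open>The difference of the two sides is \<open>4 (1 + Re w)\<close>.\<close>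
    then have "(cmod w)\<^sup>2 < (cmod (2 + w))\<^sup>2"
      unfolding cmod_power2 by (simp add: power2_eq_square algebra_simps)
    then have "cmod w < cmod (2 + w)"
      by (rule power2_less_imp_less) simp
    moreover have "\<omega> z = w / (2 + w)" by (simp add: \<omega>_def \<phi>_def w_def)
    ultimately show ?thesis
      using nz[OF \<open>z \<in> unit_disc\<close>] by (simp add: norm_divide divide_less_eq w_def)
  qed
  have "cmod (\<phi> z) \<le> 1"
  proof (cases "z = 0")
    case False
    have "cmod (\<omega> z) \<le> cmod z"
      by (rule Schwarz_Lemma(1)[OF \<omega>_hol \<omega>_0 \<omega>_less]) (use z in auto)
    then show ?thesis
      using False by (simp add: \<omega>_def norm_mult)
  next
    case True
    have "(\<phi> has_field_derivative deriv \<phi> 0) (at 0)"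
      by (rule holomorphic_derivI[OF \<phi>_hol]) auto
    then have "(\<omega> has_field_derivative \<phi> 0) (at 0)"
      unfolding \<omega>_def by (auto intro!: derivative_eq_intros)
    then have "deriv \<omega> 0 = \<phi> 0" by (rule DERIV_imp_deriv)
    moreover have "cmod (deriv \<omega> 0) \<le> 1"
      by (rule Schwarz_Lemma(2)[OF \<omega>_hol \<omega>_0 \<omega>_less, of 0]) auto
    ultimately show ?thesis using True by simp
  qed
  then show ?thesis by (simp add: \<phi>_def)
qed

text \<open>The recursion for \<open>a\<close> compares coefficients in
  \<open>h'' = \<beta> k h'\<close>, where \<open>k = (p - 1) / z\<close>. The remaining facts come
  from \<open>p\<close>, from \<open>1 / p\<close> and from the Schwarz function of
  \<open>p\<close>.\<close>

lemma convex_of_order_coefficients: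
  assumes h: "has_disc_expansion h a" and a1: "a 1 = 1" and \<beta>: "0 < \<beta>"
    and nz: "\<And>z. z \<in> unit_disc \<Longrightarrow> deriv h z \<noteq> 0"
    and order: "\<And>z. z \<in> unit_disc \<Longrightarrow> 1 - \<beta> < Re (1 + z * deriv (deriv h) z / deriv h z)"
  obtains p1 p2 p3 p4 c1 c2 c3 where
    "2 * a 2 = of_real \<beta> * p1"
    "6 * a 3 = of_real \<beta> * (p2 + 2 * a 2 * p1)"
    "12 * a 4 = of_real \<beta> * (p3 + 2 * a 2 * p2 + 3 * a 3 * p1)"
    "20 * a 5 = of_real \<beta> * (p4 + 2 * a 2 * p3 + 3 * a 3 * p2 + 4 * a 4 * p1)"
    "p1 = 2 * c1" "p2 = 2 * (c2 + c1\<^sup>2)" "p3 = 2 * (c3 + 2 * c1 * c2 + c1 ^ 3)"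
    "cmod c1 \<le> 1" "cmod c2 \<le> 1 - (cmod c1)\<^sup>2" "cmod c3 \<le> 1 - (cmod c1)\<^sup>2"
    "cmod p2 \<le> 2" "cmod p3 \<le> 2" "cmod p4 \<le> 2" "cmod (p3 - 2 * p1 * p2 + p1 ^ 3) \<le> 2"
proof -
  define H where "H = Abs_fps a"
  have h_hol: "h holomorphic_on unit_disc"
    using h by (simp add: has_disc_expansion_def)
  have h_exp: "h has_fps_expansion H"
    unfolding H_def by (rule has_disc_expansion_imp_has_fps_expansion[OF h])
  define k where "k = (\<lambda>z. deriv (deriv h) z / (of_real \<beta> * deriv h z))"
  have k_hol: "k holomorphic_on unit_disc"
    unfolding k_def by (intro holomorphic_intros h_hol) (use nz \<beta> in auto)
  define K where "K = fps_expansion k 0"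
  have k_exp: "k has_fps_expansion K"
    unfolding K_def by (rule holomorphic_on_disc_imp_has_fps_expansion[OF k_hol])
  have "fps_deriv (fps_deriv H) = fps_const (of_real \<beta>) * (K * fps_deriv H)"
  proof (rule has_fps_expansion_unique_on_disc)
    show "deriv (deriv h) has_fps_expansion fps_deriv (fps_deriv H)"
      by (intro fps_expansion_intros h_exp)
    show "(\<lambda>z. of_real \<beta> * (k z * deriv h z)) has_fps_expansion fps_const (of_real \<beta>) * (K * fps_deriv H)"
      by (intro fps_expansion_intros h_exp k_exp)
    show "deriv (deriv h) z = of_real \<beta> * (k z * deriv h z)" if "z \<in> unit_disc" for z
      using nz[OF that] \<beta> by (simp add: k_def)
  qed
  then have K_eq: "fps_nth (fps_deriv (fps_deriv H)) n = of_real \<beta> * fps_nth (K * fps_deriv H) n" for n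
    by simp
  define p where "p = (\<lambda>z. 1 + z * k z)"
  have p_pos: "0 < Re (p z)" if "z \<in> unit_disc" for z
  proof -
    have "z * k z = (z * deriv (deriv h) z / deriv h z) / of_real \<beta>"
      by (simp add: k_def)
    then have "Re (z * k z) = Re (z * deriv (deriv h) z / deriv h z) / \<beta>"
      by (simp only: Re_divide_of_real)
    moreover have "- \<beta> < Re (z * deriv (deriv h) z / deriv h z)"
      using order[OF that] by simp
    then have "- 1 < Re (z * deriv (deriv h) z / deriv h z) / \<beta>"
      using \<beta> by (simp add: pos_less_divide_eq)
    ultimately show ?thesis
      by (simp add: p_def del: times_complex.sel)
  qed
  have p_nz: "p z \<noteq> 0" if "z \<in> unit_disc" for z
    using p_pos[OF that] by auto
  have p_hol: "p holomorphic_on unit_disc"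
    unfolding p_def by (intro holomorphic_intros k_hol)
  have p_exp: "p has_fps_expansion 1 + fps_X * K"
    unfolding p_def by (intro fps_expansion_intros k_exp)
  have p_bound: "cmod (fps_nth K n) \<le> 2" for n
    using caratheodory_coeff_bound[OF p_hol p_exp p_pos, of "Suc n"] by simp
  \<comment> \<open>The reciprocal of \<open>p\<close> also has positive real part and constant term
    1; up to sign its third coefficient is \<open>p3 - 2 p1 p2 + p1^3\<close>.\<close>
  define q where "q = (\<lambda>z. inverse (p z))"
  have q_hol: "q holomorphic_on unit_disc"
    unfolding q_def by (intro holomorphic_intros p_hol p_nz)
  define Q where "Q = fps_expansion q 0"
  have q_exp: "q has_fps_expansion Q"
    unfolding Q_def by (rule holomorphic_on_disc_imp_has_fps_expansion[OF q_hol])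
  have "Q * (1 + fps_X * K) = 1"
  proof (rule has_fps_expansion_unique_on_disc)
    show "(\<lambda>z. q z * p z) has_fps_expansion Q * (1 + fps_X * K)"
      by (intro fps_expansion_intros q_exp p_exp)
    show "(\<lambda>z. 1) has_fps_expansion 1" by (rule has_fps_expansion_1)
    show "q z * p z = 1" if "z \<in> unit_disc" for z
      using p_nz[OF that] by (simp add: q_def)
  qed
  then have Q_eq: "fps_nth (Q * (1 + fps_X * K)) n = fps_nth 1 n" for n by simp
  have Q0: "fps_nth Q 0 = 1" using Q_eq[of 0] by simp
  have q_pos: "0 < Re (q z)" if "z \<in> unit_disc" for z
    using p_pos[OF that] p_nz[OF that]
    by (auto simp: q_def Re_complex_div_gt_0 complex_eq_iff sum_power2_gt_zero_iff intro!: divide_pos_pos)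
  have q_bound: "cmod (fps_nth Q 3) \<le> 2"
    by (rule caratheodory_coeff_bound[OF q_hol q_exp q_pos Q0]) auto
  define \<phi> where "\<phi> = (\<lambda>z. k z / (2 + z * k z))"
  have nz2: "2 + z * k z \<noteq> 0" if "z \<in> unit_disc" for z
  proof
    assume "2 + z * k z = 0"
    then have "p z = -1" by (simp add: p_def algebra_simps add_eq_0_iff)
    with p_pos[OF that] show False by simp
  qed
  have \<phi>_hol: "\<phi> holomorphic_on unit_disc"
    unfolding \<phi>_def by (intro holomorphic_intros k_hol nz2)
  have \<phi>_le: "cmod (\<phi> z) \<le> 1" if "z \<in> unit_disc" for z
    unfolding \<phi>_def by (rule norm_quotient_le_1_if_Re_pos[OF k_hol p_pos[unfolded p_def] that])
  define C where "C = fps_expansion \<phi> 0"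
  have \<phi>_exp: "\<phi> has_fps_expansion C"
    unfolding C_def by (rule holomorphic_on_disc_imp_has_fps_expansion[OF \<phi>_hol])
  have "K = C * (2 + fps_X * K)"
  proof (rule has_fps_expansion_unique_on_disc)
    show "(\<lambda>z. \<phi> z * (2 + z * k z)) has_fps_expansion C * (2 + fps_X * K)"
      by (intro fps_expansion_intros \<phi>_exp k_exp)
    show "k z = \<phi> z * (2 + z * k z)" if "z \<in> unit_disc" for z
      using nz2[OF that] by (simp add: \<phi>_def)
  qed (rule k_exp)
  then have C_eq: "fps_nth K n = fps_nth (C * (2 + fps_X * K)) n" for n by simp
  note nth_simps = fps_mult_nth numeral_eq_Suc H_def fps_numeral_nth
  \<comment> \<open>Dividing by \<open>z\<close> shifts indices: coefficient \<open>n\<close> of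
    \<open>K\<close> is \<open>p_(n+1)\<close>, and coefficient \<open>n\<close> of \<open>C\<close>
    is \<open>c_(n+1)\<close>.\<close>
  show thesis
  proof (rule that)
    show "2 * a 2 = of_real \<beta> * fps_nth K 0"
      using K_eq[of 0] a1 by (simp add: nth_simps)
    show "6 * a 3 = of_real \<beta> * (fps_nth K 1 + 2 * a 2 * fps_nth K 0)"
      using K_eq[of 1] a1 by (simp add: nth_simps algebra_simps)
    show "12 * a 4 = of_real \<beta> * (fps_nth K 2 + 2 * a 2 * fps_nth K 1 + 3 * a 3 * fps_nth K 0)"
      using K_eq[of 2] a1 by (simp add: nth_simps algebra_simps)
    show "20 * a 5 = of_real \<beta> * (fps_nth K 3 + 2 * a 2 * fps_nth K 2 + 3 * a 3 * fps_nth K 1 + 4 * a 4 * fps_nth K 0)"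
      using K_eq[of 3] a1 by (simp add: nth_simps algebra_simps)
    show K0: "fps_nth K 0 = 2 * fps_nth C 0"
      using C_eq[of 0] by (simp add: nth_simps)
    have K1: "fps_nth K 1 = 2 * fps_nth C 1 + fps_nth C 0 * fps_nth K 0"
      using C_eq[of 1] by (simp add: nth_simps)
    then show K1': "fps_nth K 1 = 2 * (fps_nth C 1 + (fps_nth C 0)\<^sup>2)"
      by (simp add: K0 power2_eq_square)
    have K2: "fps_nth K 2 = 2 * fps_nth C 2 + fps_nth C 1 * fps_nth K 0 + fps_nth C 0 * fps_nth K 1"
      using C_eq[of 2] by (simp add: nth_simps)
    then show "fps_nth K 2 = 2 * (fps_nth C 2 + 2 * fps_nth C 0 * fps_nth C 1 + fps_nth C 0 ^ 3)"
      unfolding K0 K1' by algebra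
    show "cmod (fps_nth C 0) \<le> 1"
      by (rule fps_nth_bound_if_norm_le_1[OF \<phi>_hol \<phi>_exp \<phi>_le])
    show "cmod (fps_nth C 1) \<le> 1 - (cmod (fps_nth C 0))\<^sup>2" "cmod (fps_nth C 2) \<le> 1 - (cmod (fps_nth C 0))\<^sup>2"
      by (rule schur_coeff_bound[OF \<phi>_hol \<phi>_exp \<phi>_le]; simp)+
    have Q1: "fps_nth Q 1 = - fps_nth K 0"
      using Q_eq[of 1] by (simp add: nth_simps Q0 add_eq_0_iff)
    have Q2: "fps_nth Q 2 = - (fps_nth K 1 + fps_nth Q 1 * fps_nth K 0)"
      using Q_eq[of 2] by (simp add: nth_simps Q0 add_eq_0_iff)
    have Q3: "fps_nth Q 3 = - (fps_nth K 2 + fps_nth Q 1 * fps_nth K 1 + fps_nth Q 2 * fps_nth K 0)"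
      using Q_eq[of 3] by (simp add: nth_simps Q0 add_eq_0_iff)
    have "fps_nth K 2 - 2 * fps_nth K 0 * fps_nth K 1 + fps_nth K 0 ^ 3 = - fps_nth Q 3"
      unfolding Q3 Q2 Q1 by algebra
    then show "cmod (fps_nth K 2 - 2 * fps_nth K 0 * fps_nth K 1 + fps_nth K 0 ^ 3) \<le> 2"
      using q_bound by simp
  qed (rule p_bound)+
qed

text \<open>Coefficient comparison in \<open>g' = z h'\<close>; the case \<open>n = 0\<close> yields
  \<open>b 1 = 0\<close>.\<close>

lemma deriv_eq_times_deriv_coefficients:
  assumes h: "has_disc_expansion h a" and g: "has_disc_expansion g b"
    and eq: "\<And>z. z \<in> unit_disc \<Longrightarrow> deriv g z = z * deriv h z"
  shows "of_nat (Suc n) * b (Suc n) = of_nat n * a n"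
proof -
  have "fps_deriv (Abs_fps b) = fps_X * fps_deriv (Abs_fps a)"
  proof (rule has_fps_expansion_unique_on_disc)
    show "deriv g has_fps_expansion fps_deriv (Abs_fps b)"
      by (intro fps_expansion_intros has_disc_expansion_imp_has_fps_expansion[OF g])
    show "(\<lambda>z. z * deriv h z) has_fps_expansion fps_X * fps_deriv (Abs_fps a)"
      by (intro fps_expansion_intros has_disc_expansion_imp_has_fps_expansion[OF h])
  qed (rule eq)
  then have "fps_nth (fps_deriv (Abs_fps b)) n = fps_nth (fps_X * fps_deriv (Abs_fps a)) n"
    by simp
  then show ?thesis
    by (cases n) simp_all
qed

section \<open>Evaluation and estimation of the two Hankel determinants\<close>

theorem theorem3:
  fixes \<alpha> :: real
    and f h g :: "complex \<Rightarrow> complex"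
    and a b :: "nat \<Rightarrow> complex"
  assumes "- 1 / 2 \<le> \<alpha>" and "\<alpha> < 1"
    and "f \<in> harmonic_class_M \<alpha>"
    and "normalized_decomposition f h g a b"
  shows "cmod (hankel_3_1 a) \<le> 1 / 540 * (1 - \<alpha>)\<^sup>2 * (15 * \<alpha>\<^sup>2 - 34 * \<alpha> + 52) \<and>
         cmod (hankel_3_1 b) \<le> 1 / 30 * (1 - \<alpha>)"
proof -
  define \<beta> where "\<beta> = 1 - \<alpha>"
  have \<beta>: "0 < \<beta>" "\<beta> \<le> 3 / 2" using assms by (auto simp: \<beta>_def)
  define B where "B = complex_of_real \<beta>"
  have norm_B: "cmod B = \<beta>" using \<beta> by (simp add: B_def)
  \<comment> \<open>The class conditions hold for a decomposition that may differ from the given one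
    off the disc. By uniqueness both have the same coefficients, so the argument continues with
    \<open>h'\<close>, \<open>g'\<close> and \<open>a\<close>, \<open>b\<close>.\<close>
  obtain h' g' a' b' where dec: "normalized_decomposition f h' g' a' b'"
    and cond: "\<And>z. z \<in> unit_disc \<Longrightarrow> deriv h' z \<noteq> 0 \<and>
              Re (1 + z * deriv (deriv h') z / deriv h' z) > \<alpha> \<and> deriv g' z = z * deriv h' z"
    using assms(3) unfolding harmonic_class_M_def by blast
  have expansions: "has_disc_expansion h a" "has_disc_expansion g b" and a1: "a 1 = 1"
    using assms(4) by (auto simp: normalized_decomposition_def)
  have "h' has_fps_expansion Abs_fps a'" "g' has_fps_expansion Abs_fps b'"
    using dec by (auto simp: normalized_decomposition_def intro: has_disc_expansion_imp_has_fps_expansion)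
  moreover have "h has_fps_expansion Abs_fps a" "g has_fps_expansion Abs_fps b"
    using expansions by (auto intro: has_disc_expansion_imp_has_fps_expansion)
  ultimately have "Abs_fps a' = Abs_fps a" "Abs_fps b' = Abs_fps b"
    using normalized_decomposition_unique[OF dec assms(4)] has_fps_expansion_unique_on_disc by blast+
  then have "a' = a" "b' = b"
    by (simp_all add: Abs_fps_inject)
  have expansions': "has_disc_expansion h' a" "has_disc_expansion g' b"
    using dec unfolding \<open>a' = a\<close> \<open>b' = b\<close> by (auto simp: normalized_decomposition_def)
  have nz: "deriv h' z \<noteq> 0" and order: "1 - \<beta> < Re (1 + z * deriv (deriv h') z / deriv h' z)"
    if "z \<in> unit_disc" for z
    using cond[OF that] by (simp_all add: \<beta>_def)
  obtain p1 p2 p3 p4 c1 c2 c3 where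
    rec: "2 * a 2 = B * p1"
    "6 * a 3 = B * (p2 + 2 * a 2 * p1)"
    "12 * a 4 = B * (p3 + 2 * a 2 * p2 + 3 * a 3 * p1)"
    "20 * a 5 = B * (p4 + 2 * a 2 * p3 + 3 * a 3 * p2 + 4 * a 4 * p1)"
    and p: "p1 = 2 * c1" "p2 = 2 * (c2 + c1\<^sup>2)" "p3 = 2 * (c3 + 2 * c1 * c2 + c1 ^ 3)"
    and c: "cmod c1 \<le> 1" "cmod c2 \<le> 1 - (cmod c1)\<^sup>2" "cmod c3 \<le> 1 - (cmod c1)\<^sup>2"
    and bounds: "cmod p2 \<le> 2" "cmod p3 \<le> 2" "cmod p4 \<le> 2" "cmod (p3 - 2 * p1 * p2 + p1 ^ 3) \<le> 2"
    by (rule convex_of_order_coefficients[OF expansions'(1) a1 \<beta>(1) nz order, folded B_def])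
  \<comment> \<open>These are \<open>2 a2\<close>, \<open>6 a3\<close>, \<open>24 a4\<close>,
    \<open>120 a5\<close>: the solved recursion without denominators.\<close>
  define x2 x3 x4 x5 where "x2 = B * p1" and "x3 = B * (p2 + B * p1\<^sup>2)"
    and "x4 = B * (2 * p3 + 3 * B * p1 * p2 + B\<^sup>2 * p1 ^ 3)"
    and "x5 = B * (6 * p4 + 8 * B * p1 * p3 + 3 * B * p2\<^sup>2 + 6 * B\<^sup>2 * p1\<^sup>2 * p2 + B ^ 3 * p1 ^ 4)"
  note x_defs = x2_def x3_def x4_def x5_def
  have a2: "2 * a 2 = x2" using rec(1) by (simp add: x2_def)
  have a3: "6 * a 3 = x3" using rec(1,2) unfolding x_defs by algebra
  have a4: "24 * a 4 = x4" using rec(1,3) a3 unfolding x_defs by algebra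
  have a5: "120 * a 5 = x5" using rec(1,4) a3 a4 unfolding x_defs by algebra
  have a_eqs: "a 2 = x2 / 2" "a 3 = x3 / 6" "a 4 = x4 / 24" "a 5 = x5 / 120"
    using a2 a3 a4 a5 by (simp_all add: field_simps)
  have "p3 - p1 * p2 = 2 * (c3 - c1 ^ 3)"
    unfolding p by algebra
  \<comment> \<open>The bound \<open>1 - |c1|^2\<close> for \<open>c3\<close> leaves room for
    \<open>|c1|^3 \<le> |c1|^2\<close>.\<close>
  moreover have "cmod (c3 - c1 ^ 3) \<le> 1"
  proof -
    have "cmod (c1 ^ 3) \<le> (cmod c1)\<^sup>2"
      unfolding norm_power using c(1) by (intro power_decreasing) auto
    then show ?thesis
      using norm_triangle_ineq4[of c3 "c1 ^ 3"] c(3) by linarith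
  qed
  ultimately have livingston: "cmod (p3 - p1 * p2) \<le> 2"
    by (simp only: norm_mult norm_numeral)
  \<comment> \<open>8640 is the least common denominator of the five products.\<close>
  have "8640 * hankel_3_1 a = 12 * x3 * x5 + 60 * x2 * x3 * x4 - 15 * x4\<^sup>2 - 18 * x2\<^sup>2 * x5 - 40 * x3 ^ 3"
    unfolding hankel_3_1_eq a1 a_eqs by (simp add: power2_eq_square power3_eq_cube)
  also have "\<dots> = B\<^sup>2 * (- 60 * p3\<^sup>2 + 72 * p2 * p4 - 36 * B * p1\<^sup>2 * p4 + 36 * B * p1 * p2 * p3 - 4 * B * p2 ^ 3
            - 21 * B\<^sup>2 * p1\<^sup>2 * p2\<^sup>2 + 12 * B\<^sup>2 * p1 ^ 3 * p3 + 6 * B ^ 3 * p1 ^ 4 * p2 - B ^ 4 * p1 ^ 6)"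
    (is "_ = _ * ?E")
    unfolding x_defs by algebra
  finally have "cmod (8640 * hankel_3_1 a) = cmod (B\<^sup>2 * ?E)"
    by (rule arg_cong)
  then have "8640 * cmod (hankel_3_1 a) = cmod (B\<^sup>2) * cmod ?E"
    unfolding norm_mult[of 8640] norm_mult[of "B\<^sup>2"] norm_numeral .
  moreover have "cmod ?E \<le> 528 + 64 * \<beta> + 240 * \<beta>\<^sup>2"
    unfolding B_def by (rule hankel_functional_bound[OF \<beta> c p bounds(1-3) livingston])
  ultimately have "8640 * cmod (hankel_3_1 a) \<le> \<beta>\<^sup>2 * (528 + 64 * \<beta> + 240 * \<beta>\<^sup>2)"
    by (simp only: norm_B norm_power) (rule mult_left_mono, simp_all)
  also have "\<dots> = 16 * (1 - \<alpha>)\<^sup>2 * (15 * \<alpha>\<^sup>2 - 34 * \<alpha> + 52)"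
    by (simp add: \<beta>_def power2_eq_square algebra_simps)
  finally have 1: "cmod (hankel_3_1 a) \<le> 1 / 540 * (1 - \<alpha>)\<^sup>2 * (15 * \<alpha>\<^sup>2 - 34 * \<alpha> + 52)"
    by simp
  have b_rec: "of_nat (Suc n) * b (Suc n) = of_nat n * a n" for n
    by (rule deriv_eq_times_deriv_coefficients[OF expansions']) (use cond in auto)
  have "2 * b 2 = 1"
    using b_rec[of 1] a1 by (simp add: numeral_2_eq_2)
  moreover have "b 1 = 0" "3 * b 3 = x2" "8 * b 4 = x3" "30 * b 5 = x4"
    using b_rec[of 0] b_rec[of 2] b_rec[of 3] b_rec[of 4] by (simp_all add: a_eqs)
  ultimately have b_eqs: "b 1 = 0" "b 2 = 1 / 2" "b 3 = x2 / 3" "b 4 = x3 / 8" "b 5 = x4 / 30"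
    by (simp_all add: field_simps)
  \<comment> \<open>As \<open>b 1 = 0\<close>, only three products survive, with least common
    denominator 1080.\<close>
  have "1080 * hankel_3_1 b = 45 * x2 * x3 - 9 * x4 - 40 * x2 ^ 3"
    unfolding hankel_3_1_eq b_eqs by (simp add: power2_eq_square power3_eq_cube)
  also have "\<dots> = - (18 * (B * (p3 - B * p1 * p2 + 2 / 9 * B\<^sup>2 * p1 ^ 3)))"
    unfolding x_defs by (simp add: power2_eq_square power3_eq_cube algebra_simps)
  finally have "cmod (1080 * hankel_3_1 b) = cmod (18 * (B * (p3 - B * p1 * p2 + 2 / 9 * B\<^sup>2 * p1 ^ 3)))"
    by (simp only: norm_minus_cancel)
  then have "1080 * cmod (hankel_3_1 b) = 18 * (\<beta> * cmod (p3 - B * p1 * p2 + 2 / 9 * B\<^sup>2 * p1 ^ 3))"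
    by (simp only: norm_mult[of 1080] norm_mult[of 18] norm_mult[of B] norm_B norm_numeral)
  also have "\<dots> \<le> 18 * (\<beta> * 2)"
    using cubic_functional_bound[OF _ \<beta>(2) bounds(2) livingston bounds(4)] \<beta>
    by (simp add: B_def)
  finally have 2: "cmod (hankel_3_1 b) \<le> 1 / 30 * (1 - \<alpha>)"
    by (simp add: \<beta>_def)
  from 1 2 show ?thesis ..
qed

end
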